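(* Let $f:G_1\to G_2$ be a continuous homomorphism between (matrix) Lie groups $G_1$ and $G_2$. Then there exists a Lie-algebra homomorphism $Df:\mathcal{L}(G_1)\to\mathcal{L}(G_2)$ such that $$\exp(Df(X))=f(\exp(X))\quad\text{for all } X\in\mathcal{L}(G_1).$$
   Context: A (matrix) Lie group is a closed subgroup of $\mathrm{GL}_d(\mathbb{R})$ for some $d$ (the size may differ for $G_1$ and $G_2$). The Lie algebra of a Lie group $G\subset\mathrm{GL}_d(\mathbb{R})$ is $\mathcal{L}(G)=\{X\in\mathrm{M}_d(\mathbb{R}):\exp(tX)\in G\text{ for all }t\in\mathbb{R}\}$, where $\exp(A)=\sum_{n\ge0}A^n/n!$; it is a real vector space closed under $[X,Y]=XY-YX$. A Lie-algebra homomorphism is an $\mathbb{R}$-linear map preserving the bracket $[\cdot,\cdot]$. *)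

theory Defs
  imports "HOL-Analysis.Analysis" "HOL-Algebra.Group"
begin

definition GL_group :: "(real^'n^'n) monoid" where
  "GL_group = \<lparr>carrier = {A. invertible A}, monoid.mult = (**), one = mat 1\<rparr>"

lemma group_GL_group: "group (GL_group :: (real^'n^'n) monoid)"
proof (rule groupI)
  fix A :: "real^'n^'n"
  assume "A \<in> carrier GL_group"
  then obtain B where "A ** B = mat 1" "B ** A = mat 1"
    by (auto simp: GL_group_def invertible_def)
  then show "\<exists>B\<in>carrier GL_group. B \<otimes>\<^bsub>GL_group\<^esub> A = \<one>\<^bsub>GL_group\<^esub>"
    by (auto simp: GL_group_def invertible_def)
next
  have "mat 1 ** mat 1 = (mat 1 :: real^'n^'n)"
    by simp
  then show "\<one>\<^bsub>GL_group\<^esub> \<in> carrier (GL_group :: (real^'n^'n) monoid)"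
    unfolding GL_group_def invertible_def by auto
qed (simp_all add: GL_group_def invertible_mult matrix_mul_assoc)

(* "Closed" means relatively closed in GL_d(R), which is itself not closed in M_d(R). *)
definition matrix_lie_group :: "(real^'n^'n) set \<Rightarrow> bool" where
  "matrix_lie_group G \<longleftrightarrow>
     subgroup G GL_group \<and> closedin (top_of_set (carrier GL_group)) G"

(* The library's times, power and exp do not apply here: on the vector type
   multiplication is componentwise, and the type is not a real normed algebra. *)
definition matrix_power :: "real^'n^'n \<Rightarrow> nat \<Rightarrow> real^'n^'n" where
  "matrix_power A n = (((**) A) ^^ n) (mat 1)"

definition matrix_exp :: "real^'n^'n \<Rightarrow> real^'n^'n" where
  "matrix_exp A = (\<Sum>n. matrix_power A n /\<^sub>R fact n)"

lemma summable_matrix_exp: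
  fixes A :: "real^'n^'n"
  shows "summable (\<lambda>n. matrix_power A n /\<^sub>R fact n)"
proof -
  have rdistrib: "(B + C) ** D = B ** D + C ** D" for B C D :: "real^'n^'n"
    by (simp only: matrix_matrix_mult_def vec_eq_iff vec_lambda_beta vector_add_component
        distrib_right sum.distrib simp_thms)
  have "bilinear ((**) :: real^'n^'n \<Rightarrow> real^'n^'n \<Rightarrow> real^'n^'n)"
    unfolding bilinear_def
    by (intro conjI allI linearI)
      (simp_all only: matrix_add_ldistrib rdistrib matrix_scalar_ac scalar_matrix_assoc)
  then have "bounded_bilinear ((**) :: real^'n^'n \<Rightarrow> real^'n^'n \<Rightarrow> real^'n^'n)"
    by (simp only: bilinear_conv_bounded_bilinear)
  from bounded_bilinear.pos_bounded[OF this]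
  obtain K where K: "K > 0" "\<And>(B :: real^'n^'n) (C :: real^'n^'n). norm (B ** C) \<le> norm B * norm C * K"
    by blast
  define c where "c = norm A * K"
  have "c \<ge> 0" using K(1) by (simp add: c_def)
  have bound: "norm (matrix_power A n) \<le> norm (mat 1 :: real^'n^'n) * c ^ n" for n
  proof (induction n)
    case (Suc n)
    have "norm (matrix_power A (Suc n)) \<le> c * norm (matrix_power A n)"
      using K(2)[of A "matrix_power A n"]
      by (simp add: matrix_power_def c_def mult.assoc mult.commute[of K])
    also have "\<dots> \<le> c * (norm (mat 1 :: real^'n^'n) * c ^ n)"
      using Suc \<open>c \<ge> 0\<close> by (rule mult_left_mono)
    finally show ?case by (simp only: power_Suc mult.left_commute)
  qed (simp add: matrix_power_def)
  have "summable (\<lambda>n. norm (mat 1 :: real^'n^'n) * (c ^ n /\<^sub>R fact n))"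
    by (intro summable_mult summable_exp_generic)
  then show ?thesis
  proof (rule summable_comparison_test'[where N = 0])
    fix n :: nat
    show "norm (matrix_power A n /\<^sub>R fact n) \<le> norm (mat 1 :: real^'n^'n) * (c ^ n /\<^sub>R fact n)"
      using mult_left_mono[OF bound[of n], of "inverse (fact n)"] by (simp add: mult_ac)
  qed
qed

definition lie_algebra :: "(real^'n^'n) set \<Rightarrow> (real^'n^'n) set" where
  "lie_algebra G = {X. \<forall>t::real. matrix_exp (t *\<^sub>R X) \<in> G}"

definition lie_bracket :: "real^'n^'n \<Rightarrow> real^'n^'n \<Rightarrow> real^'n^'n" where
  "lie_bracket X Y = X ** Y - Y ** X"

(* D is a total function, but only its values on L are constrained. *)
definition lie_algebra_hom ::
  "(real^'n^'n) set \<Rightarrow> (real^'m^'m) set \<Rightarrow> (real^'n^'n \<Rightarrow> real^'m^'m) \<Rightarrow> bool" where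
  "lie_algebra_hom L M D \<longleftrightarrow>
     D \<in> L \<rightarrow> M \<and>
     (\<forall>X\<in>L. \<forall>Y\<in>L. D (X + Y) = D X + D Y) \<and>
     (\<forall>c::real. \<forall>X\<in>L. D (c *\<^sub>R X) = c *\<^sub>R D X) \<and>
     (\<forall>X\<in>L. \<forall>Y\<in>L. D (lie_bracket X Y) = lie_bracket (D X) (D Y))"

end

theory Submission
  imports Defs
begin

text \<open>
  For \<open>X\<close> in the Lie algebra of \<open>G1\<close>, the curve \<open>t \<mapsto> f (exp (t X))\<close> is a continuous homomorphism from
  the real line to \<open>G2\<close>.  Every such homomorphism is \<open>t \<mapsto> exp (t Y)\<close> for a unique \<open>Y\<close>
  (\<open>one_parameter_subgroup_exp\<close>, \<open>matrix_exp_scaleR_inject\<close>), and this \<open>Y\<close> is the value of \<open>Df\<close>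
  at \<open>X\<close>.  The exponential identity is the case \<open>t = 1\<close>, and homogeneity is immediate from uniqueness.

  Additivity comes from Lie's product formula (\<open>matrix_trotter\<close>), which writes \<open>exp (t (X + Y))\<close> as the
  limit of \<open>(exp (t X / n) exp (t Y / n)) ^ n\<close>: the homomorphism \<open>f\<close> commutes with the products and,
  being continuous, with the limit.  The formula also shows that the Lie algebra of a closed group is a
  vector space (\<open>subspace_lie_algebra\<close>).

  For the bracket, uniqueness of generators gives \<open>Df (g X g\<inverse>) = f g Df X (f g)\<inverse>\<close> for \<open>g\<close> in \<open>G1\<close>.
  With \<open>g = exp (s X)\<close> this says that \<open>Df\<close> maps the curve \<open>exp (s X) Y exp (-s X)\<close> to
  \<open>exp (s Df X) Df Y exp (-s Df X)\<close>.  The derivatives of these curves at \<open>s = 0\<close> are the brackets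
  (\<open>conjugation_has_vector_derivative\<close>), and \<open>Df\<close>, a linear map on a finite-dimensional space, commutes
  with differentiation.

  The analysis of the exponential takes place in an arbitrary Banach algebra and is transferred to
  matrices through their identification with endomorphisms of Euclidean space.
\<close>

section \<open>A product formula for the exponential\<close>

lemma has_vector_derivative_at_0_iff_quotient:
  fixes f :: "real \<Rightarrow> 'a::real_normed_vector"
  shows "(f has_vector_derivative D) (at 0) \<longleftrightarrow> ((\<lambda>t. (f t - f 0) /\<^sub>R t) \<longlongrightarrow> D) (at 0)"
proof -
  have "(f has_vector_derivative D) (at 0) \<longleftrightarrow>
      ((\<lambda>t. norm (f t - f 0 - t *\<^sub>R D) / norm t) \<longlongrightarrow> 0) (at 0)"
    by (simp add: has_vector_derivative_def has_derivative_at bounded_linear_scaleR_left)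
  also have "\<dots> \<longleftrightarrow> ((\<lambda>t. norm ((f t - f 0) /\<^sub>R t - D)) \<longlongrightarrow> 0) (at 0)"
  proof (rule filterlim_cong[OF refl refl])
    show "\<forall>\<^sub>F t in at (0::real). norm (f t - f 0 - t *\<^sub>R D) / norm t = norm ((f t - f 0) /\<^sub>R t - D)"
    proof (rule eventually_at_filter[THEN iffD2, OF always_eventually], intro allI impI)
      fix t :: real assume "t \<noteq> 0"
      then have "(f t - f 0) /\<^sub>R t - D = (f t - f 0 - t *\<^sub>R D) /\<^sub>R t"
        by (simp add: algebra_simps)
      then show "norm (f t - f 0 - t *\<^sub>R D) / norm t = norm ((f t - f 0) /\<^sub>R t - D)"
        by (simp add: divide_inverse mult.commute)
    qed
  qed
  finally show ?thesis
    by (simp add: tendsto_norm_zero_iff LIM_zero_iff)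
qed

text \<open>The sequence starts at \<^term>\<open>inverse (real (Suc 0))\<close>, so that the denominator is never zero;
  the product formulas below use the same indexing.\<close>
lemma difference_quotient_LIMSEQ:
  fixes f :: "real \<Rightarrow> 'a::real_normed_vector"
  assumes "(f has_vector_derivative D) (at 0)"
  shows "(\<lambda>n. real (Suc n) *\<^sub>R (f (inverse (real (Suc n))) - f 0)) \<longlonglongrightarrow> D"
proof -
  have "filterlim (\<lambda>n. inverse (real (Suc n))) (at 0) sequentially"
    using LIMSEQ_inverse_real_of_nat by (simp add: filterlim_at)
  from filterlim_compose[OF assms[unfolded has_vector_derivative_at_0_iff_quotient] this]
  show ?thesis by simp
qed

text \<open>Telescoping, for a pair that need not commute.  The sharp factor would be
  \<^term>\<open>M ^ (n - 1)\<close>; with \<open>M \<ge> 1\<close> the weaker \<^term>\<open>M ^ n\<close> avoids the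
  truncated subtraction.\<close>
lemma norm_power_diff_le:
  fixes a b :: "'a::real_normed_algebra_1"
  assumes "norm a \<le> M" "norm b \<le> M" "1 \<le> M"
  shows "norm (a ^ n - b ^ n) \<le> real n * M ^ n * norm (a - b)"
proof (induction n)
  case (Suc n)
  have M: "M ^ n \<le> M ^ Suc n" "0 \<le> M ^ n"
    using assms(3) by (simp_all add: mult_le_cancel_right1)
  have "a ^ Suc n - b ^ Suc n = a * (a ^ n - b ^ n) + (a - b) * b ^ n"
    by (simp add: algebra_simps)
  then have "norm (a ^ Suc n - b ^ Suc n) \<le> norm a * norm (a ^ n - b ^ n) + norm (a - b) * norm (b ^ n)"
    by (metis norm_triangle_mono norm_mult_ineq)
  also have "\<dots> \<le> M * (real n * M ^ n * norm (a - b)) + norm (a - b) * M ^ Suc n"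
  proof (intro add_mono mult_mono)
    have "norm (b ^ n) \<le> M ^ n"
      by (meson assms(2) norm_ge_zero norm_power_ineq order_trans power_mono)
    then show "norm (b ^ n) \<le> M ^ Suc n" using M by linarith
  qed (use assms Suc in auto)
  also have "\<dots> = real (Suc n) * M ^ Suc n * norm (a - b)"
    by (simp add: algebra_simps)
  finally show ?case .
qed simp

lemma exp_scaleR_of_nat:
  fixes X :: "'a::{real_normed_algebra_1,banach}"
  shows "exp (real n *\<^sub>R X) = exp X ^ n"
proof (induction n)
  case (Suc n)
  have "exp (X + real n *\<^sub>R X) = exp X * exp (real n *\<^sub>R X)"
    by (rule exp_add_commuting) simp
  with Suc show ?case by (simp add: algebra_simps)
qed simp

text \<open>Only the tangent of \<^term>\<open>g\<close> at \<open>0\<close> matters: the curve \<open>exp (t Z)\<close> satisfies the claim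
  with equality, and \<^term>\<open>g\<close> differs from it at \<open>1/n\<close> by \<open>o(1/n)\<close>.  Taking \<open>n\<close>-th powers
  multiplies this error by at most \<open>n\<close> times a bound that does not depend on \<open>n\<close>, because both
  factors have norm at most \<open>exp (K/n)\<close>.\<close>
theorem tangent_product_formula:
  fixes g :: "real \<Rightarrow> 'a::{real_normed_algebra_1,banach}"
  assumes g0: "g 0 = 1" and g': "(g has_vector_derivative Z) (at 0)"
  shows "(\<lambda>n. g (inverse (real (Suc n))) ^ Suc n) \<longlonglongrightarrow> exp Z"
proof -
  define h where "h n = inverse (real (Suc n))" for n
  define e where "e t = exp (t *\<^sub>R Z)" for t
  \<comment> \<open>Any constant larger than the limit \<^term>\<open>norm Z\<close> of the difference quotients works.\<close>
  define K where "K = norm Z + 1"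
  have e': "(e has_vector_derivative Z) (at 0)"
    using exp_scaleR_has_vector_derivative_right[of Z 0 UNIV] by (simp add: e_def[abs_def])
  have e_pow: "e (h n) ^ Suc n = exp Z" for n
    by (simp add: e_def h_def exp_scaleR_of_nat[symmetric] del: power_Suc of_nat_Suc)
  have "((\<lambda>t. g t - e t) has_vector_derivative Z - Z) (at 0)"
    by (rule has_vector_derivative_diff[OF g' e'])
  from difference_quotient_LIMSEQ[OF this]
  have small: "(\<lambda>n. real (Suc n) *\<^sub>R (g (h n) - e (h n))) \<longlonglongrightarrow> 0"
    by (simp add: g0 e_def h_def)
  have "(\<lambda>n. norm (real (Suc n) *\<^sub>R (g (h n) - 1))) \<longlonglongrightarrow> norm Z"
    using tendsto_norm[OF difference_quotient_LIMSEQ[OF g']] by (simp add: g0 h_def)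
  then have "\<forall>\<^sub>F n in sequentially. norm (real (Suc n) *\<^sub>R (g (h n) - 1)) < K"
    by (rule order_tendstoD) (simp add: K_def)
  then have bound: "\<forall>\<^sub>F n in sequentially.
      norm (g (h n) ^ Suc n - exp Z) \<le> exp K * norm (real (Suc n) *\<^sub>R (g (h n) - e (h n)))"
  proof eventually_elim
    case (elim n)
    have hpos: "h n > 0" by (simp add: h_def)
    have K0: "K \<ge> 0" by (simp add: K_def)
    have "real (Suc n) * norm (g (h n) - 1) < K"
      using elim by (simp only: norm_scaleR abs_of_nat)
    then have near: "norm (g (h n) - 1) \<le> h n * K"
      using mult_left_mono[of "real (Suc n) * norm (g (h n) - 1)" K "h n"] hpos
      by (simp add: h_def mult.assoc[symmetric] del: of_nat_Suc)
    have "norm (g (h n)) \<le> norm (g (h n) - 1) + 1"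
      by (metis norm_one norm_triangle_sub add.commute)
    also have "norm (g (h n) - 1) \<le> h n * K"
      by (rule near)
    also have "h n * K + 1 \<le> exp (h n * K)"
      using exp_ge_add_one_self[of "h n * K"] by (simp only: add.commute)
    finally have 1: "norm (g (h n)) \<le> exp (h n * K)" by simp
    have "norm (e (h n)) \<le> exp (norm (h n *\<^sub>R Z))"
      unfolding e_def by (rule norm_exp)
    also have "\<dots> \<le> exp (h n * K)"
      using hpos by (simp add: K_def)
    finally have 2: "norm (e (h n)) \<le> exp (h n * K)" .
    have "norm (g (h n) ^ Suc n - e (h n) ^ Suc n)
        \<le> real (Suc n) * exp (h n * K) ^ Suc n * norm (g (h n) - e (h n))"
      by (rule norm_power_diff_le[OF 1 2]) (use hpos K0 in simp)
    also have "exp (h n * K) ^ Suc n = exp K"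
      using exp_scaleR_of_nat[of "Suc n" "h n * K"] by (simp add: h_def mult.assoc[symmetric] del: power_Suc of_nat_Suc)
    finally show ?case
      unfolding e_pow by (simp add: mult_ac)
  qed
  have "(\<lambda>n. exp K * norm (real (Suc n) *\<^sub>R (g (h n) - e (h n)))) \<longlonglongrightarrow> 0"
    using tendsto_mult_right_zero[OF tendsto_norm_zero[OF small]] by simp
  then have "(\<lambda>n. g (h n) ^ Suc n - exp Z) \<longlonglongrightarrow> 0"
    by (rule Lim_null_comparison[OF bound])
  then show ?thesis
    by (simp add: LIM_zero_iff h_def)
qed

section \<open>One-parameter groups in a Banach algebra\<close>

text \<open>The inverse is the Neumann series of \<^term>\<open>1 - u\<close>.\<close>
lemma right_invertible_near_one:
  fixes u :: "'a::{real_normed_algebra_1,banach}"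
  assumes "norm (1 - u) < 1"
  obtains v where "u * v = 1"
proof -
  define v where "v = (\<Sum>n. (1 - u) ^ n)"
  have s: "summable (\<lambda>n. (1 - u) ^ n)"
    by (rule complete_algebra_summable_geometric[OF assms])
  have "(1 - u) * v = (\<Sum>n. (1 - u) ^ Suc n)"
    unfolding v_def by (simp add: suminf_mult[OF s])
  also have "\<dots> = v - 1"
    unfolding v_def using suminf_split_head[OF s] by simp
  finally have "u * v = 1" by (simp add: algebra_simps)
  then show ?thesis by (rule that)
qed

text \<open>Integration smooths: since \<open>c\<close> is multiplicative, \<open>c h\<close> times the integral \<open>J\<close> of \<open>c\<close> over
  \<open>[0, a]\<close> is the integral of \<open>c\<close> over \<open>[h, a + h]\<close>, which is differentiable in \<open>h\<close>
  because \<open>c\<close> is continuous.  For small \<open>a\<close> the mean value \<open>J / a\<close> is close to \<open>c 0 = 1\<close>, so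
  \<open>J\<close> can be cancelled.\<close>
lemma multiplicative_curve_differentiable:
  fixes c :: "real \<Rightarrow> 'a::{real_normed_algebra_1,banach}"
  assumes cont: "continuous_on UNIV c" and c0: "c 0 = 1"
    and mult: "\<And>s t. c (s + t) = c s * c t"
  obtains Y where "(c has_vector_derivative Y) (at 0)"
proof -
  have cont': "continuous_on S c" for S
    using cont by (rule continuous_on_subset) simp
  have int: "c integrable_on {a..b}" for a b
    by (rule integrable_continuous_real[OF cont'])
  obtain d where d: "d > 0" "\<And>s. \<bar>s\<bar> < d \<Longrightarrow> norm (c s - 1) < 1/2"
    using cont[unfolded continuous_on_iff, rule_format, of 0 "1/2"] by (auto simp: c0 dist_norm)
  define a where "a = d / 2"
  have a: "a > 0" "a < d" using d by (auto simp: a_def)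
  define J where "J = integral {0..a} c"
  have "norm (integral {0..a} (\<lambda>s. c s - 1)) \<le> 1/2 * (a - 0)"
  proof (rule integral_bound)
    show "norm (c s - 1) \<le> 1/2" if "s \<in> {0..a}" for s
      using d(2)[of s] that a by auto
  qed (use a in \<open>auto intro!: continuous_intros cont'\<close>)
  also have "integral {0..a} (\<lambda>s. c s - 1) = J - a *\<^sub>R 1"
    using a by (simp add: J_def Henstock_Kurzweil_Integration.integral_diff[OF int integrable_const_ivl])
  finally have "norm (J - a *\<^sub>R 1) \<le> a / 2" by simp
  moreover have "1 - J /\<^sub>R a = (a *\<^sub>R 1 - J) /\<^sub>R a"
    using a by (simp add: algebra_simps)
  ultimately have "norm (1 - J /\<^sub>R a) < 1"
    using a by (simp add: norm_minus_commute pos_less_divide_eq divide_inverse_commute[symmetric])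
  then obtain v where "(J /\<^sub>R a) * v = 1" by (rule right_invertible_near_one)
  then have v: "J * (v /\<^sub>R a) = 1" by simp
  \<comment> \<open>The lower limit is negative so that \<open>0\<close> is an interior point, which gives a two-sided
    derivative there.\<close>
  define P where "P u = integral {-a..u} c" for u
  have P: "(P has_vector_derivative c x) (at x)" if "x \<in> {-a<..<2*a}" for x
  proof -
    have "(P has_vector_derivative c x) (at x within {-a..2*a})"
      unfolding P_def using that by (intro integral_has_vector_derivative cont') auto
    then show ?thesis
      using that by (simp add: at_within_Icc_at)
  qed
  have P_diff: "c h * J = P (a + h) - P h" if h: "h \<in> {-a<..<a}" for h
  proof -
    have "c h * J = integral {0..a} (\<lambda>s. c h * c s)"
      unfolding J_def using integral_linear[OF int bounded_linear_mult_right] by (simp add: o_def)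
    also have "\<dots> = integral {0..a} (\<lambda>s. c (s + h))"
      by (simp add: mult[symmetric] add.commute)
    also have "\<dots> = integral {h..a + h} c"
      using integral_shift_real_ivl[of h h "a + h" c] by simp
    also have "\<dots> = P (a + h) - P h"
      unfolding P_def using Henstock_Kurzweil_Integration.integral_combine[of "-a" h "a + h" c] h a int
      by (simp add: algebra_simps)
    finally show ?thesis .
  qed
  have "((\<lambda>h. a + h) has_vector_derivative 1) (at 0)"
    by (auto intro!: derivative_eq_intros)
  from vector_diff_chain_at[OF this, of P "c a"] P[of a] a
  have "((\<lambda>h. P (a + h)) has_vector_derivative c a) (at 0)"
    by (simp add: o_def)
  then have "((\<lambda>h. (P (a + h) - P h) * (v /\<^sub>R a)) has_vector_derivative (c a - c 0) * (v /\<^sub>R a)) (at 0)"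
    using a by (auto intro!: derivative_eq_intros P)
  then have "(c has_vector_derivative (c a - c 0) * (v /\<^sub>R a)) (at 0)"
  proof (rule has_vector_derivative_transform_within_open[where S = "{-a<..<a}"])
    fix h assume "h \<in> {-a<..<a}"
    from P_diff[OF this, symmetric] show "(P (a + h) - P h) * (v /\<^sub>R a) = c h"
      by (metis mult.assoc mult.right_neutral v)
  qed (use a in auto)
  then show ?thesis by (rule that)
qed

text \<open>Multiplicativity spreads the derivative \<open>Y\<close> at \<open>0\<close> to the equation \<open>c' = c Y\<close>, so
  \<open>c t exp (-t Y)\<close> has derivative zero.\<close>
theorem one_parameter_subgroup_exp:
  fixes c :: "real \<Rightarrow> 'a::{real_normed_algebra_1,banach}"
  assumes cont: "continuous_on UNIV c" and c0: "c 0 = 1"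
    and mult: "\<And>s t. c (s + t) = c s * c t"
  obtains Y where "\<And>t. c t = exp (t *\<^sub>R Y)"
proof -
  obtain Y where Y: "(c has_vector_derivative Y) (at 0)"
    using multiplicative_curve_differentiable[OF assms] .
  have c': "(c has_vector_derivative c t * Y) (at t)" for t
  proof -
    have "((\<lambda>s. s - t) has_vector_derivative 1) (at t)"
      by (auto intro!: derivative_eq_intros)
    from vector_diff_chain_at[OF this, of c Y] Y
    have "((\<lambda>s. c (s - t)) has_vector_derivative Y) (at t)"
      by (simp add: o_def)
    then have "((\<lambda>s. c t * c (s - t)) has_vector_derivative c t * Y) (at t)"
      by (auto intro!: derivative_eq_intros)
    then show ?thesis by (simp add: mult[symmetric])
  qed
  have "((\<lambda>t. c t * exp (t *\<^sub>R (- Y))) has_vector_derivative 0) (at t)" for t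
    by (rule has_vector_derivative_eq_rhs[OF has_vector_derivative_mult
          [OF c' exp_scaleR_has_vector_derivative_left[of "- Y"]]]) (simp add: mult.assoc)
  then obtain k where k: "\<And>t. c t * exp (t *\<^sub>R (- Y)) = k"
    using has_vector_derivative_zero_constant[of UNIV "\<lambda>t. c t * exp (t *\<^sub>R (- Y))"] by auto
  have "k = 1" using k[of 0] c0 by simp
  have "c t = exp (t *\<^sub>R Y)" for t
  proof -
    have "c t * (exp (- (t *\<^sub>R Y)) * exp (t *\<^sub>R Y)) = exp (t *\<^sub>R Y)"
      using k[of t] \<open>k = 1\<close> by (simp add: mult.assoc[symmetric])
    moreover have "exp (- (t *\<^sub>R Y)) * exp (t *\<^sub>R Y) = 1"
      using exp_minus_inverse[of "- (t *\<^sub>R Y)"] by simp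
    ultimately show ?thesis by simp
  qed
  then show ?thesis by (rule that)
qed

section \<open>The Banach algebra of endomorphisms\<close>

text \<open>The product on \<^typ>\<open>real^'n^'n\<close> given by its type class is the componentwise one, and its norm
  is the Euclidean norm, for which the identity matrix has norm 1 only in dimension one.  A separate type of
  endomorphisms of Euclidean space, with composition and the operator norm, is a Banach algebra, so the general theory
  of \<^const>\<open>exp\<close> applies to it.\<close>
typedef (overloaded) 'a endo = "UNIV :: ('a::real_normed_vector \<Rightarrow>\<^sub>L 'a) set"
  by simp

setup_lifting type_definition_endo

instantiation endo :: (real_normed_vector) real_normed_vector
begin

lift_definition zero_endo :: "'a endo" is 0 .
lift_definition plus_endo :: "'a endo \<Rightarrow> 'a endo \<Rightarrow> 'a endo" is "(+)" .
lift_definition minus_endo :: "'a endo \<Rightarrow> 'a endo \<Rightarrow> 'a endo" is "(-)" .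
lift_definition uminus_endo :: "'a endo \<Rightarrow> 'a endo" is uminus .
lift_definition scaleR_endo :: "real \<Rightarrow> 'a endo \<Rightarrow> 'a endo" is "(*\<^sub>R)" .
lift_definition norm_endo :: "'a endo \<Rightarrow> real" is norm .
definition sgn_endo :: "'a endo \<Rightarrow> 'a endo" where
  "sgn_endo x = inverse (norm x) *\<^sub>R x"
definition dist_endo :: "'a endo \<Rightarrow> 'a endo \<Rightarrow> real" where
  "dist_endo x y = norm (x - y)"
definition uniformity_endo :: "('a endo \<times> 'a endo) filter" where
  "uniformity_endo = (INF e\<in>{0<..}. principal {(x, y). dist x y < e})"
definition open_endo :: "'a endo set \<Rightarrow> bool" where
  "open_endo U \<longleftrightarrow> (\<forall>x\<in>U. \<forall>\<^sub>F (x', y) in uniformity. x' = x \<longrightarrow> y \<in> U)"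

instance
  by standard
    ((simp add: sgn_endo_def dist_endo_def uniformity_endo_def open_endo_def; fail)
      | (transfer, simp add: algebra_simps norm_triangle_ineq))+

end

instance endo :: (banach) banach
proof
  fix X :: "nat \<Rightarrow> 'a endo"
  assume "Cauchy X"
  then have "Cauchy (\<lambda>n. Rep_endo (X n))"
    by (simp add: Cauchy_def dist_norm norm_endo.rep_eq minus_endo.rep_eq)
  then obtain L where "(\<lambda>n. Rep_endo (X n)) \<longlonglongrightarrow> L"
    using Cauchy_convergent convergentD by blast
  then have "X \<longlonglongrightarrow> Abs_endo L"
    by (simp add: LIMSEQ_iff norm_endo.rep_eq minus_endo.rep_eq Abs_endo_inverse)
  then show "convergent X" by (rule convergentI)
qed

instantiation endo :: ("{real_normed_vector, perfect_space}") real_normed_algebra_1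
begin

lift_definition one_endo :: "'a endo" is id_blinfun .
lift_definition times_endo :: "'a endo \<Rightarrow> 'a endo \<Rightarrow> 'a endo" is "(o\<^sub>L)" .

instance
proof
  interpret bounded_bilinear "(o\<^sub>L) :: ('a \<Rightarrow>\<^sub>L 'a) \<Rightarrow> ('a \<Rightarrow>\<^sub>L 'a) \<Rightarrow> ('a \<Rightarrow>\<^sub>L 'a)"
    by (rule bounded_bilinear_blinfun_compose)
  fix x y z :: "'a endo" and r :: real
  show "x * y * z = x * (y * z)" by transfer (auto intro: blinfun_eqI)
  show "1 * x = x" by transfer (auto intro: blinfun_eqI)
  show "x * 1 = x" by transfer (auto intro: blinfun_eqI)
  show "(x + y) * z = x * z + y * z" by transfer (rule add_left)
  show "x * (y + z) = x * y + x * z" by transfer (rule add_right)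
  show "r *\<^sub>R x * y = r *\<^sub>R (x * y)" by transfer (rule scaleR_left)
  show "x * r *\<^sub>R y = r *\<^sub>R (x * y)" by transfer (rule scaleR_right)
  show "norm (x * y) \<le> norm x * norm y" by transfer (rule norm_blinfun_compose)
  show "norm (1 :: 'a endo) = 1" by transfer simp
  then show "(0 :: 'a endo) \<noteq> 1" by (metis norm_zero zero_neq_one)
qed

end

section \<open>Matrices as endomorphisms\<close>

lift_definition endo_of_matrix :: "real^'n^'n \<Rightarrow> (real^'n) endo"
  is "\<lambda>A. Blinfun ((*v) A)" .

lemma matrix_endo_apply: "blinfun_apply (Rep_endo (endo_of_matrix A)) x = A *v x"
  by (simp add: endo_of_matrix.rep_eq bounded_linear_Blinfun_apply)

lemma endo_eqI:
  assumes "\<And>x. blinfun_apply (Rep_endo S) x = blinfun_apply (Rep_endo T) x"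
  shows "S = T"
  using assms by (metis Rep_endo_inject blinfun_eqI)

lemmas endo_apply_simps = matrix_endo_apply plus_endo.rep_eq scaleR_endo.rep_eq
  times_endo.rep_eq one_endo.rep_eq blinfun.bilinear_simps

lemma endo_of_matrix_mult: "endo_of_matrix (A ** B) = endo_of_matrix A * endo_of_matrix B"
  by (rule endo_eqI) (simp add: endo_apply_simps matrix_vector_mul_assoc)

lemma endo_of_matrix_one: "endo_of_matrix (mat 1) = 1"
  by (rule endo_eqI) (simp add: endo_apply_simps)

lemma bounded_linear_endo_of_matrix: "bounded_linear endo_of_matrix"
proof (rule linear_conv_bounded_linear[THEN iffD1], rule linearI)
  show "endo_of_matrix (A + B) = endo_of_matrix A + endo_of_matrix B" for A B :: "real^'n^'n"
    by (rule endo_eqI) (simp add: endo_apply_simps matrix_vector_mult_add_rdistrib)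
  show "endo_of_matrix (r *\<^sub>R A) = r *\<^sub>R endo_of_matrix A" for r and A :: "real^'n^'n"
    by (rule endo_eqI) (simp add: endo_apply_simps scaleR_matrix_vector_assoc)
qed

text \<open>Limits and derivatives found in the endomorphism algebra return to matrices along the
  inverse of \<^const>\<open>endo_of_matrix\<close>, which therefore has to be bounded as well.\<close>
lift_definition matrix_of_endo :: "(real^'n) endo \<Rightarrow> real^'n^'n"
  is "\<lambda>T. matrix (blinfun_apply T)" .

lemma matrix_of_endo_of_matrix: "matrix_of_endo (endo_of_matrix A) = A"
  by (simp add: matrix_of_endo.rep_eq endo_of_matrix.rep_eq bounded_linear_Blinfun_apply)

lemma endo_of_matrix_of_endo: "endo_of_matrix (matrix_of_endo T) = T"
  by (rule endo_eqI) (simp add: matrix_endo_apply matrix_of_endo.rep_eq matrix_works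
      blinfun.bounded_linear_right bounded_linear.linear)

lemma bounded_linear_matrix_of_endo: "bounded_linear matrix_of_endo"
proof (rule bounded_linear_intro)
  interpret bounded_linear endo_of_matrix by (rule bounded_linear_endo_of_matrix)
  show "matrix_of_endo (S + T) = matrix_of_endo S + matrix_of_endo T" for S T :: "(real^'n) endo"
    by (metis add endo_of_matrix_of_endo matrix_of_endo_of_matrix)
  show "matrix_of_endo (r *\<^sub>R S) = r *\<^sub>R matrix_of_endo S" for r and S :: "(real^'n) endo"
    by (metis scaleR endo_of_matrix_of_endo matrix_of_endo_of_matrix)
  show "norm (matrix_of_endo T) \<le> norm T * (\<Sum>i\<in>(UNIV :: 'n set). \<Sum>j\<in>(UNIV :: 'n set). 1)"
    for T :: "(real^'n) endo"
  proof -
    have entry: "norm (matrix_of_endo T $ i $ j) \<le> norm T * 1" for i j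
    proof -
      have "norm (matrix_of_endo T $ i $ j) \<le> norm (blinfun_apply (Rep_endo T) (axis j 1))"
        by (simp add: matrix_of_endo.rep_eq matrix_def component_le_norm_cart)
      also have "\<dots> \<le> norm T * 1"
        using norm_blinfun[of "Rep_endo T" "axis j 1"] by (simp add: norm_endo.rep_eq norm_axis_1)
      finally show ?thesis .
    qed
    have "norm (matrix_of_endo T) \<le> (\<Sum>i\<in>UNIV. norm (matrix_of_endo T $ i))"
      unfolding norm_vec_def[of "matrix_of_endo T"] by (rule L2_set_le_sum) simp
    also have "\<dots> \<le> (\<Sum>i\<in>UNIV. \<Sum>j\<in>UNIV. norm (matrix_of_endo T $ i $ j))"
    proof (rule sum_mono)
      show "norm (matrix_of_endo T $ i) \<le> (\<Sum>j\<in>UNIV. norm (matrix_of_endo T $ i $ j))" for i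
        unfolding norm_vec_def[of "matrix_of_endo T $ i"] by (rule L2_set_le_sum) simp
    qed
    also have "\<dots> \<le> (\<Sum>i\<in>(UNIV :: 'n set). \<Sum>j\<in>(UNIV :: 'n set). norm T * 1)"
      by (intro sum_mono entry)
    finally show ?thesis by (simp add: mult_ac)
  qed
qed

lemma endo_of_matrix_power: "endo_of_matrix (matrix_power A n) = endo_of_matrix A ^ n"
  by (induction n) (simp_all add: matrix_power_def endo_of_matrix_one endo_of_matrix_mult)

lemma endo_of_matrix_exp: "endo_of_matrix (matrix_exp A) = exp (endo_of_matrix A)"
proof -
  interpret bounded_linear endo_of_matrix by (rule bounded_linear_endo_of_matrix)
  show ?thesis
    unfolding matrix_exp_def exp_def suminf[OF summable_matrix_exp]
    by (simp add: scaleR endo_of_matrix_power)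
qed

lemma endo_of_matrix_eq_iff: "endo_of_matrix A = endo_of_matrix B \<longleftrightarrow> A = B"
  by (metis matrix_of_endo_of_matrix)

lemma endo_of_matrix_scaleR: "endo_of_matrix (r *\<^sub>R A) = r *\<^sub>R endo_of_matrix A"
  by (simp add: linear_simps[OF bounded_linear_endo_of_matrix])

lemma endo_of_matrix_add: "endo_of_matrix (A + B) = endo_of_matrix A + endo_of_matrix B"
  by (simp add: linear_simps[OF bounded_linear_endo_of_matrix])

section \<open>The matrix exponential\<close>

lemma bounded_bilinear_matrix_mult:
  "bounded_bilinear ((**) :: real^'n^'n \<Rightarrow> real^'n^'n \<Rightarrow> real^'n^'n)"
  unfolding bilinear_conv_bounded_bilinear[symmetric] bilinear_def
  by (intro conjI allI linearI; subst endo_of_matrix_eq_iff[symmetric])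
    (simp_all add: endo_of_matrix_mult endo_of_matrix_add endo_of_matrix_scaleR algebra_simps)

lemma matrix_exp_zero: "matrix_exp 0 = mat 1"
  by (subst endo_of_matrix_eq_iff[symmetric])
    (simp add: endo_of_matrix_exp endo_of_matrix_one linear_simps[OF bounded_linear_endo_of_matrix])

lemma matrix_exp_add_scaleR:
  "matrix_exp ((s + t) *\<^sub>R X) = matrix_exp (s *\<^sub>R X) ** matrix_exp (t *\<^sub>R X)"
proof -
  have "exp (s *\<^sub>R endo_of_matrix X + t *\<^sub>R endo_of_matrix X)
      = exp (s *\<^sub>R endo_of_matrix X) * exp (t *\<^sub>R endo_of_matrix X)"
    by (rule exp_add_commuting) simp
  then show ?thesis
    by (subst endo_of_matrix_eq_iff[symmetric])
      (simp add: endo_of_matrix_exp endo_of_matrix_mult endo_of_matrix_scaleR endo_of_matrix_add scaleR_add_left)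
qed

lemma matrix_exp_scaleR_inverse:
  "matrix_exp (t *\<^sub>R X) ** matrix_exp (- t *\<^sub>R X) = mat 1"
  "matrix_exp (- t *\<^sub>R X) ** matrix_exp (t *\<^sub>R X) = mat 1"
  using matrix_exp_add_scaleR[of t "- t" X] matrix_exp_add_scaleR[of "- t" t X]
  by (simp_all add: matrix_exp_zero)

lemma matrix_exp_has_vector_derivative:
  "((\<lambda>t. matrix_exp (t *\<^sub>R X)) has_vector_derivative matrix_exp (t *\<^sub>R X) ** X) (at t)"
  using bounded_linear.has_vector_derivative[OF bounded_linear_matrix_of_endo
      exp_scaleR_has_vector_derivative_right[of "endo_of_matrix X" t UNIV]]
  by (simp only: endo_of_matrix_scaleR[symmetric] endo_of_matrix_exp[symmetric]
      endo_of_matrix_mult[symmetric] matrix_of_endo_of_matrix)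

lemma matrix_exp_has_vector_derivative_0:
  "((\<lambda>t. matrix_exp (t *\<^sub>R X)) has_vector_derivative X) (at 0)"
  using matrix_exp_has_vector_derivative[of X 0] by (simp add: matrix_exp_zero)

lemma continuous_on_matrix_exp_scaleR: "continuous_on S (\<lambda>t. matrix_exp (t *\<^sub>R X))"
  by (intro continuous_at_imp_continuous_on ballI)
    (rule has_vector_derivative_continuous[OF matrix_exp_has_vector_derivative])

text \<open>A one-parameter group determines its generator, as the derivative at \<open>0\<close>.\<close>
lemma matrix_exp_scaleR_inject:
  assumes "\<And>t. matrix_exp (t *\<^sub>R X) = matrix_exp (t *\<^sub>R Y)"
  shows "X = Y"
  using matrix_exp_has_vector_derivative_0[of X] matrix_exp_has_vector_derivative_0[of Y]
  unfolding assms by (rule vector_derivative_unique_at)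

text \<open>Conjugation is linear and commutes with powers, so it can be carried out term by term in the
  exponential series.\<close>
lemma matrix_exp_conjugate:
  fixes P Q X :: "real^'n^'n"
  assumes "P ** Q = mat 1" and "Q ** P = mat 1"
  shows "matrix_exp (P ** X ** Q) = P ** matrix_exp X ** Q"
proof -
  have pow: "matrix_power (P ** X ** Q) n = P ** matrix_power X n ** Q" for n
  proof (induction n)
    case (Suc n)
    have "P ** X ** Q ** (P ** matrix_power X n ** Q)
        = P ** X ** (Q ** P) ** matrix_power X n ** Q"
      by (simp only: matrix_mul_assoc)
    with Suc show ?case
      by (simp add: matrix_power_def assms matrix_mul_assoc)
  qed (simp add: matrix_power_def assms)
  have bl: "bounded_linear (\<lambda>A. P ** A ** Q)"
    by (rule bounded_linear_compose[of "\<lambda>A. A ** Q" "\<lambda>A. P ** A"])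
      (rule bounded_bilinear.bounded_linear_left[OF bounded_bilinear_matrix_mult]
        bounded_bilinear.bounded_linear_right[OF bounded_bilinear_matrix_mult])+
  show ?thesis
    unfolding matrix_exp_def bounded_linear.suminf[OF bl summable_matrix_exp]
    by (simp add: pow linear_simps[OF bl])
qed

text \<open>Lie's product formula: the curve \<open>exp (t X) exp (t Y)\<close> has tangent \<open>X + Y\<close> at \<open>0\<close>.\<close>
theorem matrix_trotter:
  "(\<lambda>n. matrix_power (matrix_exp (inverse (real (Suc n)) *\<^sub>R X)
        ** matrix_exp (inverse (real (Suc n)) *\<^sub>R Y)) (Suc n))
    \<longlonglongrightarrow> matrix_exp (X + Y)"
proof -
  let ?X = "endo_of_matrix X" and ?Y = "endo_of_matrix Y"
  have "((\<lambda>t. exp (t *\<^sub>R ?X) * exp (t *\<^sub>R ?Y)) has_vector_derivative ?X + ?Y) (at 0)"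
    by (rule has_vector_derivative_eq_rhs[OF has_vector_derivative_mult
          [OF exp_scaleR_has_vector_derivative_right exp_scaleR_has_vector_derivative_right]])
      simp
  from tangent_product_formula[OF _ this]
  have "(\<lambda>n. (exp (inverse (real (Suc n)) *\<^sub>R ?X) * exp (inverse (real (Suc n)) *\<^sub>R ?Y)) ^ Suc n)
      \<longlonglongrightarrow> exp (?X + ?Y)"
    by simp
  from bounded_linear.tendsto[OF bounded_linear_matrix_of_endo this]
  show ?thesis
    by (simp only: matrix_of_endo_of_matrix endo_of_matrix_exp[symmetric] endo_of_matrix_scaleR[symmetric]
        endo_of_matrix_mult[symmetric] endo_of_matrix_power[symmetric] endo_of_matrix_add[symmetric])
qed

theorem matrix_one_parameter_subgroup:
  fixes c :: "real \<Rightarrow> real^'n^'n"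
  assumes cont: "continuous_on UNIV c" and c0: "c 0 = mat 1"
    and mult: "\<And>s t. c (s + t) = c s ** c t"
  obtains Y where "\<And>t. c t = matrix_exp (t *\<^sub>R Y)"
proof -
  have "continuous_on UNIV (\<lambda>t. endo_of_matrix (c t))"
    by (rule bounded_linear.continuous_on[OF bounded_linear_endo_of_matrix cont])
  then obtain Z where Z: "\<And>t. endo_of_matrix (c t) = exp (t *\<^sub>R Z)"
    by (rule one_parameter_subgroup_exp)
      (simp_all add: c0 mult endo_of_matrix_one endo_of_matrix_mult)
  have "c t = matrix_exp (t *\<^sub>R matrix_of_endo Z)" for t
    by (subst endo_of_matrix_eq_iff[symmetric])
      (simp add: Z endo_of_matrix_exp endo_of_matrix_scaleR endo_of_matrix_of_endo)
  then show ?thesis by (rule that)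
qed

section \<open>Linear maps and curves on a subspace\<close>

text \<open>On a Euclidean space the extension is a bounded linear map;
  this is how the derivative of a curve is pushed through \<open>Df\<close>.\<close>
lemma linear_extension_from_subspace:
  fixes f :: "'a::real_vector \<Rightarrow> 'b::real_vector"
  assumes V: "subspace V"
    and add: "\<And>x y. x \<in> V \<Longrightarrow> y \<in> V \<Longrightarrow> f (x + y) = f x + f y"
    and scale: "\<And>c x. x \<in> V \<Longrightarrow> f (c *\<^sub>R x) = c *\<^sub>R f x"
  obtains g where "linear g" and "\<And>x. x \<in> V \<Longrightarrow> g x = f x"
proof -
  obtain B where B: "B \<subseteq> V" "independent B" "V \<subseteq> span B"
    using maximal_independent_subset[of V] by blast
  obtain g where g: "linear g" "\<And>x. x \<in> B \<Longrightarrow> g x = f x"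
    using linear_independent_extend[OF B(2), of f] by blast
  have "x \<in> V \<and> g x = f x" if "x \<in> span B" for x
    using that
  proof (induction rule: span_induct_alt)
    case base
    have "f 0 = 0" using scale[of 0 0] subspace_0[OF V] by simp
    then show ?case using linear_0[OF g(1)] subspace_0[OF V] by simp
  next
    case (step c x y)
    then have "x \<in> V" "c *\<^sub>R x \<in> V" using B(1) subspace_scale[OF V] by auto
    with step show ?case
      by (simp add: linear_add[OF g(1)] linear_scale[OF g(1)] g(2) add scale subspace_add[OF V])
  qed
  then show ?thesis using that g(1) B(3) by blast
qed

text \<open>The difference quotients stay in the subspace, and a subspace of a finite-dimensional space is
  closed.\<close>
lemma has_vector_derivative_in_subspace:
  fixes c :: "real \<Rightarrow> 'a::euclidean_space"
  assumes V: "subspace V" and c: "\<And>t. c t \<in> V" and c': "(c has_vector_derivative Z) (at 0)"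
  shows "Z \<in> V"
proof (rule Lim_in_closed_set)
  show "closed V" by (rule closed_subspace[OF V])
  show "((\<lambda>t. (c t - c 0) /\<^sub>R t) \<longlongrightarrow> Z) (at 0)"
    using c' by (simp add: has_vector_derivative_at_0_iff_quotient)
  show "\<forall>\<^sub>F t in at 0. (c t - c 0) /\<^sub>R t \<in> V"
    by (intro always_eventually allI subspace_scale subspace_diff V c)
qed simp

section \<open>Closed matrix groups and their Lie algebras\<close>

text \<open>Elements of a Lie group can converge to a singular matrix, hence the invertibility hypothesis in
  the closure property.\<close>
lemma
  assumes "matrix_lie_group G"
  shows matrix_lie_group_one: "mat 1 \<in> G"
    and matrix_lie_group_mult: "A \<in> G \<Longrightarrow> B \<in> G \<Longrightarrow> A ** B \<in> G"
    and matrix_lie_group_invertible: "A \<in> G \<Longrightarrow> invertible A"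
    and matrix_lie_group_limit:
      "(\<And>n. S n \<in> G) \<Longrightarrow> S \<longlonglongrightarrow> L \<Longrightarrow> invertible L \<Longrightarrow> L \<in> G"
proof -
  have sub: "subgroup G GL_group" and "closedin (top_of_set (carrier GL_group)) G"
    using assms by (auto simp: matrix_lie_group_def)
  then obtain T where T: "closed T" "G = carrier GL_group \<inter> T"
    by (auto simp: closedin_closed)
  show "mat 1 \<in> G" using subgroup.one_closed[OF sub] by (simp add: GL_group_def)
  show "A \<in> G \<Longrightarrow> B \<in> G \<Longrightarrow> A ** B \<in> G"
    using subgroup.m_closed[OF sub, of A B] by (simp add: GL_group_def)
  show "A \<in> G \<Longrightarrow> invertible A"
    using T by (auto simp: GL_group_def)
  show "L \<in> G" if "\<And>n. S n \<in> G" "S \<longlonglongrightarrow> L" "invertible L"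
    using closed_sequentially[OF T(1), of S L] that T(2) by (auto simp: GL_group_def)
qed

lemma matrix_lie_group_power: "matrix_lie_group G \<Longrightarrow> A \<in> G \<Longrightarrow> matrix_power A n \<in> G"
  by (induction n) (simp_all add: matrix_power_def matrix_lie_group_one matrix_lie_group_mult)

lemma invertible_matrix_exp: "invertible (matrix_exp X)"
  unfolding invertible_def
  using matrix_exp_scaleR_inverse[of 1 X] by auto

lemma lie_algebra_exp: "X \<in> lie_algebra G \<Longrightarrow> matrix_exp (t *\<^sub>R X) \<in> G"
  by (simp add: lie_algebra_def)

lemma matrix_trotter_scaleR:
  "(\<lambda>n. matrix_power (matrix_exp ((t / real (Suc n)) *\<^sub>R X)
        ** matrix_exp ((t / real (Suc n)) *\<^sub>R Y)) (Suc n))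
    \<longlonglongrightarrow> matrix_exp (t *\<^sub>R (X + Y))"
  using matrix_trotter[of "t *\<^sub>R X" "t *\<^sub>R Y"]
  by (simp add: scaleR_add_right divide_inverse mult.commute del: of_nat_Suc)

text \<open>Closure under addition is the point where closedness of the group enters: the product formula
  presents \<open>exp (t (X + Y))\<close> as a limit of group elements.\<close>
lemma subspace_lie_algebra:
  assumes G: "matrix_lie_group G"
  shows "subspace (lie_algebra G)"
proof (rule subspaceI)
  show "0 \<in> lie_algebra G"
    by (simp add: lie_algebra_def matrix_exp_zero matrix_lie_group_one[OF G])
  show "c *\<^sub>R X \<in> lie_algebra G" if "X \<in> lie_algebra G" for c X
    using that by (simp add: lie_algebra_def)
  show "X + Y \<in> lie_algebra G" if "X \<in> lie_algebra G" "Y \<in> lie_algebra G" for X Y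
    unfolding lie_algebra_def
    by (intro CollectI allI, rule matrix_lie_group_limit[OF G _ matrix_trotter_scaleR])
      (intro matrix_lie_group_power matrix_lie_group_mult lie_algebra_exp that G
        invertible_matrix_exp)+
qed

lemma lie_algebra_conjugate:
  fixes P Q X :: "real^'n^'n"
  assumes G: "matrix_lie_group G" and P: "P \<in> G" "Q \<in> G" "P ** Q = mat 1" "Q ** P = mat 1"
    and X: "X \<in> lie_algebra G"
  shows "matrix_exp (t *\<^sub>R (P ** X ** Q)) = P ** matrix_exp (t *\<^sub>R X) ** Q"
    and "P ** X ** Q \<in> lie_algebra G"
proof -
  show eq: "matrix_exp (t *\<^sub>R (P ** X ** Q)) = P ** matrix_exp (t *\<^sub>R X) ** Q" for t
    using matrix_exp_conjugate[OF P(3,4), of "t *\<^sub>R X"]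
    by (simp add: matrix_scalar_ac scalar_matrix_assoc)
  show "P ** X ** Q \<in> lie_algebra G"
    using X by (auto simp: lie_algebra_def eq intro!: matrix_lie_group_mult G P)
qed

text \<open>This derivative turns the bracket into an expression in conjugations and limits, both of which a
  continuous homomorphism preserves.\<close>
lemma conjugation_has_vector_derivative:
  "((\<lambda>s. matrix_exp (s *\<^sub>R X) ** Y ** matrix_exp (- s *\<^sub>R X))
    has_vector_derivative lie_bracket X Y) (at 0)"
proof -
  note bb = bounded_bilinear.has_vector_derivative[OF bounded_bilinear_matrix_mult]
  have "((\<lambda>s. matrix_exp (s *\<^sub>R (- X))) has_vector_derivative - X) (at 0)"
    by (rule matrix_exp_has_vector_derivative_0)
  from bb[OF bb[OF matrix_exp_has_vector_derivative_0[of X] has_vector_derivative_const[of Y]] this]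
  show ?thesis
    by (simp add: matrix_exp_zero lie_bracket_def bounded_bilinear.zero_right[OF bounded_bilinear_matrix_mult]
      bounded_bilinear.minus_right[OF bounded_bilinear_matrix_mult])
qed

section \<open>The derivative of a continuous homomorphism\<close>

theorem theorem1p12:
  fixes G1 :: "(real^'n^'n) set" and G2 :: "(real^'m^'m) set"
    and f :: "real^'n^'n \<Rightarrow> real^'m^'m"
  assumes "matrix_lie_group G1" and "matrix_lie_group G2"
    and "f \<in> hom (GL_group\<lparr>carrier := G1\<rparr>) (GL_group\<lparr>carrier := G2\<rparr>)"
    and "continuous_on G1 f"
  shows "\<exists>Df. lie_algebra_hom (lie_algebra G1) (lie_algebra G2) Df \<and>
           (\<forall>X\<in>lie_algebra G1. matrix_exp (Df X) = f (matrix_exp X))"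
proof -
  note G1 = assms(1) and G2 = assms(2)
  have f_in: "f A \<in> G2" if "A \<in> G1" for A
    using assms(3) that by (auto simp: hom_def)
  have f_mult: "f (A ** B) = f A ** f B" if "A \<in> G1" "B \<in> G1" for A B
    using assms(3) that by (auto simp: hom_def GL_group_def)
  have f_one: "f (mat 1) = mat 1"
  proof -
    have "f (mat 1) ** f (mat 1) = f (mat 1)"
      using f_mult[of "mat 1" "mat 1"] matrix_lie_group_one[OF G1] by simp
    moreover obtain R where "R ** f (mat 1) = mat 1"
      using matrix_lie_group_invertible[OF G2 f_in[OF matrix_lie_group_one[OF G1]]]
      by (auto simp: invertible_def)
    ultimately show ?thesis by (metis matrix_mul_assoc matrix_mul_lid)
  qed
  have f_power: "f (matrix_power A n) = matrix_power (f A) n" if "A \<in> G1" for A n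
    using matrix_lie_group_power[OF G1 that]
    by (induction n) (simp_all add: f_one f_mult that matrix_power_def)
  have f_LIMSEQ: "(\<lambda>n. f (S n)) \<longlonglongrightarrow> f L" if "\<And>n. S n \<in> G1" "L \<in> G1" "S \<longlonglongrightarrow> L" for S L
    using assms(4) that by (auto simp: continuous_on_sequentially o_def)

  \<comment> \<open>\<open>f\<close> maps the one-parameter group of \<open>X\<close> to another one, and \<open>D X\<close> is its generator.\<close>
  have "\<exists>Y. \<forall>t. f (matrix_exp (t *\<^sub>R X)) = matrix_exp (t *\<^sub>R Y)" if X: "X \<in> lie_algebra G1" for X
  proof -
    have "continuous_on UNIV (\<lambda>t. f (matrix_exp (t *\<^sub>R X)))"
      by (rule continuous_on_compose2[OF assms(4) continuous_on_matrix_exp_scaleR])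
        (use lie_algebra_exp[OF X] in blast)
    then obtain Y where "\<And>t. f (matrix_exp (t *\<^sub>R X)) = matrix_exp (t *\<^sub>R Y)"
      by (rule matrix_one_parameter_subgroup)
        (simp_all add: matrix_exp_zero f_one matrix_exp_add_scaleR f_mult lie_algebra_exp[OF X])
    then show ?thesis by blast
  qed
  then obtain D where D: "\<And>X t. X \<in> lie_algebra G1 \<Longrightarrow>
      f (matrix_exp (t *\<^sub>R X)) = matrix_exp (t *\<^sub>R D X)"
    by metis
  \<comment> \<open>Uniqueness of generators reduces identities for \<open>D\<close> to identities between exponentials.\<close>
  have D_eq: "D X = Y"
    if "X \<in> lie_algebra G1" "\<And>t. f (matrix_exp (t *\<^sub>R X)) = matrix_exp (t *\<^sub>R Y)" for X Y
    by (rule matrix_exp_scaleR_inject) (use D that in metis)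

  note L1 = subspace_lie_algebra[OF G1]
  have D_in: "D X \<in> lie_algebra G2" if "X \<in> lie_algebra G1" for X
    unfolding lie_algebra_def using f_in[OF lie_algebra_exp[OF that]] by (simp add: D[OF that])
  have D_scale: "D (c *\<^sub>R X) = c *\<^sub>R D X" if "X \<in> lie_algebra G1" for c X
    using D[OF that] by (intro D_eq subspace_scale[OF L1] that) simp
  have D_add: "D (X + Y) = D X + D Y" if X: "X \<in> lie_algebra G1" and Y: "Y \<in> lie_algebra G1" for X Y
  proof (rule D_eq)
    show XY: "X + Y \<in> lie_algebra G1" by (rule subspace_add[OF L1 X Y])
    fix t
    let ?E = "\<lambda>n Z. matrix_exp ((t / real (Suc n)) *\<^sub>R Z)"
    have in_G: "?E n X ** ?E n Y \<in> G1" for n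
      by (intro matrix_lie_group_mult G1 lie_algebra_exp X Y)
    have "(\<lambda>n. f (matrix_power (?E n X ** ?E n Y) (Suc n)))
        \<longlonglongrightarrow> f (matrix_exp (t *\<^sub>R (X + Y)))"
      by (intro f_LIMSEQ matrix_trotter_scaleR matrix_lie_group_power in_G lie_algebra_exp XY G1)
    also have "(\<lambda>n. f (matrix_power (?E n X ** ?E n Y) (Suc n)))
        = (\<lambda>n. matrix_power (?E n (D X) ** ?E n (D Y)) (Suc n))"
      by (simp only: f_power[OF in_G] f_mult[OF lie_algebra_exp[OF X] lie_algebra_exp[OF Y]] D X Y)
    finally show "f (matrix_exp (t *\<^sub>R (X + Y))) = matrix_exp (t *\<^sub>R (D X + D Y))"
      by (rule LIMSEQ_unique[OF _ matrix_trotter_scaleR])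
  qed

  have D_conj: "D (P ** X ** Q) = f P ** D X ** f Q"
    if X: "X \<in> lie_algebra G1" and P: "P \<in> G1" "Q \<in> G1" "P ** Q = mat 1" "Q ** P = mat 1" for X P Q
  proof (rule D_eq)
    show "P ** X ** Q \<in> lie_algebra G1" by (rule lie_algebra_conjugate(2)[OF G1 P X])
    fix t
    have inv: "f P ** f Q = mat 1" "f Q ** f P = mat 1"
      using f_mult P f_one by metis+
    show "f (matrix_exp (t *\<^sub>R (P ** X ** Q))) = matrix_exp (t *\<^sub>R (f P ** D X ** f Q))"
      unfolding lie_algebra_conjugate(1)[OF G1 P X]
        lie_algebra_conjugate(1)[OF G2 f_in[OF P(1)] f_in[OF P(2)] inv D_in[OF X]]
      by (simp add: f_mult matrix_lie_group_mult[OF G1] P lie_algebra_exp[OF X] D[OF X])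
  qed

  obtain E where E: "linear E" "\<And>X. X \<in> lie_algebra G1 \<Longrightarrow> E X = D X"
    using linear_extension_from_subspace[OF L1, of D] D_add D_scale by blast
  \<comment> \<open>By \<open>D_conj\<close> the curve \<open>exp (s X) Y exp (-s X)\<close> is mapped by \<open>D\<close> to the corresponding curve
    for \<open>D X\<close> and \<open>D Y\<close>; the two sides of the bracket identity are its derivative at \<open>0\<close>.\<close>
  have D_bracket: "D (lie_bracket X Y) = lie_bracket (D X) (D Y)"
    if X: "X \<in> lie_algebra G1" and Y: "Y \<in> lie_algebra G1" for X Y
  proof -
    define c where "c s = matrix_exp (s *\<^sub>R X) ** Y ** matrix_exp (- s *\<^sub>R X)" for s
    have c': "(c has_vector_derivative lie_bracket X Y) (at 0)"
      unfolding c_def[abs_def] by (rule conjugation_has_vector_derivative)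
    note P = lie_algebra_exp[OF X] lie_algebra_exp[OF X] matrix_exp_scaleR_inverse
    have c_in: "c s \<in> lie_algebra G1" for s
      unfolding c_def by (rule lie_algebra_conjugate(2)[OF G1 P Y])
    have "E (c s) = matrix_exp (s *\<^sub>R D X) ** D Y ** matrix_exp (- s *\<^sub>R D X)" for s
      unfolding E(2)[OF c_in] unfolding c_def D_conj[OF Y P] D[OF X] ..
    then have "((\<lambda>s. E (c s)) has_vector_derivative lie_bracket (D X) (D Y)) (at 0)"
      using conjugation_has_vector_derivative[of "D X" "D Y"] by simp
    moreover have "((\<lambda>s. E (c s)) has_vector_derivative E (lie_bracket X Y)) (at 0)"
      by (rule bounded_linear.has_vector_derivative[OF linear_conv_bounded_linear[THEN iffD1, OF E(1)] c'])
    moreover have "lie_bracket X Y \<in> lie_algebra G1"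
      by (rule has_vector_derivative_in_subspace[OF L1 c_in c'])
    ultimately show ?thesis
      using vector_derivative_unique_at[of "\<lambda>s. E (c s)"] E(2) by simp
  qed

  have "lie_algebra_hom (lie_algebra G1) (lie_algebra G2) D"
    by (simp add: lie_algebra_hom_def D_in D_add D_scale D_bracket)
  moreover have "matrix_exp (D X) = f (matrix_exp X)" if "X \<in> lie_algebra G1" for X
    using D[OF that, of 1] by simp
  ultimately show ?thesis by blast
qed

end
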